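(* Let $A$ be an ISP-domain and let $B$ be a flat overring of $A$. Then $B$ is an ISP-domain.
   Context: All rings are commutative and unitary; "ideal" of a domain means integral ideal. A domain $A$ is an ISP-domain (invertible semiprime domain) if every proper nonzero ideal $I$ of $A$ can be written as $I=JQ_1\cdots Q_n$ where $n\geq 1$, $J$ is an invertible ideal of $A$ and each $Q_i$ is a proper radical ideal of $A$. An overring of a domain $A$ is a ring $B$ with $A\subseteq B\subseteq K$, where $K$ is the quotient field of $A$; it is a flat overring if $B$ is flat as an $A$-module. *)

theory Defs
  imports "HOL-Algebra.Algebra"
begin

section \<open>Flat modules\<close>

definition module_hom ::
  "('a, 'm) ring_scheme \<Rightarrow> ('a, 'b) module \<Rightarrow> ('a, 'c) module \<Rightarrow> ('b \<Rightarrow> 'c) set" where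
  "module_hom R M M' = {f \<in> carrier M \<rightarrow> carrier M'.
     (\<forall>x\<in>carrier M. \<forall>y\<in>carrier M. f (x \<oplus>\<^bsub>M\<^esub> y) = f x \<oplus>\<^bsub>M'\<^esub> f y) \<and>
     (\<forall>r\<in>carrier R. \<forall>x\<in>carrier M. f (r \<odot>\<^bsub>M\<^esub> x) = r \<odot>\<^bsub>M'\<^esub> f x)}"

text \<open>
  The tensor product over \<open>R\<close> is the free abelian group on
  \<open>carrier M \<times> carrier N\<close> modulo the subgroup generated by the biadditivity and
  balancing relations. Only its group structure is recorded, since flatness speaks only about
  injectivity of maps.
\<close>

definition tensor_relations ::
  "('a, 'm) ring_scheme \<Rightarrow> ('a, 'b) module \<Rightarrow> ('a, 'c) module \<Rightarrow> (('b \<times> 'c) \<Rightarrow>\<^sub>0 int) set" where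
  "tensor_relations R M N =
     {frag_of (x \<oplus>\<^bsub>M\<^esub> y, n) - frag_of (x, n) - frag_of (y, n) | x y n.
        x \<in> carrier M \<and> y \<in> carrier M \<and> n \<in> carrier N} \<union>
     {frag_of (x, m \<oplus>\<^bsub>N\<^esub> n) - frag_of (x, m) - frag_of (x, n) | x m n.
        x \<in> carrier M \<and> m \<in> carrier N \<and> n \<in> carrier N} \<union>
     {frag_of (r \<odot>\<^bsub>M\<^esub> x, n) - frag_of (x, r \<odot>\<^bsub>N\<^esub> n) | r x n.
        r \<in> carrier R \<and> x \<in> carrier M \<and> n \<in> carrier N}"

definition tensor_subgroup ::
  "('a, 'm) ring_scheme \<Rightarrow> ('a, 'b) module \<Rightarrow> ('a, 'c) module \<Rightarrow> (('b \<times> 'c) \<Rightarrow>\<^sub>0 int) set" where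
  "tensor_subgroup R M N =
     generate (free_Abelian_group (carrier M \<times> carrier N)) (tensor_relations R M N)"

definition tensor_product ::
  "('a, 'm) ring_scheme \<Rightarrow> ('a, 'b) module \<Rightarrow> ('a, 'c) module \<Rightarrow> (('b \<times> 'c) \<Rightarrow>\<^sub>0 int) set monoid" where
  "tensor_product R M N =
     free_Abelian_group (carrier M \<times> carrier N) Mod tensor_subgroup R M N"

text \<open>
  The map \<open>f \<otimes> id\<close> into the tensor product of \<open>M'\<close> and \<open>N\<close>. It acts on a coset by mapping
  its representatives; when \<open>f\<close> is a homomorphism all of them yield the same coset, so the union
  below is that coset.
\<close>

definition tensor_map ::
  "('a, 'm) ring_scheme \<Rightarrow> ('a, 'd) module \<Rightarrow> ('a, 'c) module \<Rightarrow> ('b \<Rightarrow> 'd) \<Rightarrow>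
     (('b \<times> 'c) \<Rightarrow>\<^sub>0 int) set \<Rightarrow> (('d \<times> 'c) \<Rightarrow>\<^sub>0 int) set" where
  "tensor_map R M' N f C =
     (\<Union>t\<in>C. tensor_subgroup R M' N #>\<^bsub>free_Abelian_group (carrier M' \<times> carrier N)\<^esub>
        frag_extend (\<lambda>(x, n). frag_of (f x, n)) t)"

text \<open>
  \<open>N\<close> is flat if tensoring with it preserves injectivity. HOL cannot quantify over modules of
  every type, so the test modules \<open>M\<close>, \<open>M'\<close> range over those whose elements have the type of the
  elements of \<open>R\<close>. This loses nothing: these include all ideals of \<open>R\<close> and \<open>R\<close> itself, and
  the inclusions of ideals into \<open>R\<close> already detect flatness.
\<close>

definition flat_module :: "('a, 'm) ring_scheme \<Rightarrow> ('a, 'c) module \<Rightarrow> bool" where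
  "flat_module R N \<longleftrightarrow> module R N \<and>
     (\<forall>(M :: ('a, 'a) module) (M' :: ('a, 'a) module) f.
        module R M \<and> module R M' \<and> f \<in> module_hom R M M' \<and> inj_on f (carrier M) \<longrightarrow>
        inj_on (tensor_map R M' N f) (carrier (tensor_product R M N)))"

section \<open>Domains inside their quotient field\<close>

text \<open>
  A domain is given as a subring \<open>A\<close> of its quotient field \<open>K\<close>; as a ring it is
  \<open>K\<lparr>carrier := A\<rparr>\<close>.
\<close>

definition is_quotient_field :: "('a, 'm) ring_scheme \<Rightarrow> 'a set \<Rightarrow> bool" where
  "is_quotient_field K A \<longleftrightarrow> field K \<and> subring A K \<and>
     (\<forall>x\<in>carrier K. \<exists>a\<in>A. \<exists>b\<in>A - {\<zero>\<^bsub>K\<^esub>}. x = a \<otimes>\<^bsub>K\<^esub> inv\<^bsub>K\<^esub> b)"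

definition overring :: "('a, 'm) ring_scheme \<Rightarrow> 'a set \<Rightarrow> 'a set \<Rightarrow> bool" where
  "overring K A B \<longleftrightarrow> is_quotient_field K A \<and> subring B K \<and> A \<subseteq> B"

text \<open>\<open>B\<close> with scalar multiplication by elements of a subring.\<close>

definition subring_module :: "('a, 'm) ring_scheme \<Rightarrow> 'a set \<Rightarrow> ('a, 'a) module" where
  "subring_module K B =
     \<lparr>carrier = B, monoid.mult = monoid.mult K, one = one K,
      ring.zero = ring.zero K, ring.add = ring.add K,
      smult = monoid.mult K\<rparr>"

definition flat_overring :: "('a, 'm) ring_scheme \<Rightarrow> 'a set \<Rightarrow> 'a set \<Rightarrow> bool" where
  "flat_overring K A B \<longleftrightarrow>
     overring K A B \<and> flat_module (K\<lparr>carrier := A\<rparr>) (subring_module K B)"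

section \<open>ISP-domains\<close>

definition fractional_ideal :: "('a, 'm) ring_scheme \<Rightarrow> 'a set \<Rightarrow> 'a set \<Rightarrow> bool" where
  "fractional_ideal K A J \<longleftrightarrow> additive_subgroup J K \<and>
     (\<forall>a\<in>A. \<forall>x\<in>J. a \<otimes>\<^bsub>K\<^esub> x \<in> J) \<and>
     (\<exists>d\<in>A - {\<zero>\<^bsub>K\<^esub>}. \<forall>x\<in>J. d \<otimes>\<^bsub>K\<^esub> x \<in> A)"

text \<open>\<open>ideal_prod K\<close> forms the finite sums of products computed in \<open>K\<close>, so it also gives the
  product of fractional ideals.\<close>

definition invertible_ideal :: "('a, 'm) ring_scheme \<Rightarrow> 'a set \<Rightarrow> 'a set \<Rightarrow> bool" where
  "invertible_ideal K A J \<longleftrightarrow> ideal J (K\<lparr>carrier := A\<rparr>) \<and>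
     (\<exists>J'. fractional_ideal K A J' \<and> J \<cdot>\<^bsub>K\<^esub> J' = A)"

definition radical :: "('a, 'm) ring_scheme \<Rightarrow> 'a set \<Rightarrow> 'a set" where
  "radical R I = {x \<in> carrier R. \<exists>n::nat. n \<ge> 1 \<and> x [^]\<^bsub>R\<^esub> n \<in> I}"

definition radical_ideal :: "('a, 'm) ring_scheme \<Rightarrow> 'a set \<Rightarrow> bool" where
  "radical_ideal R I \<longleftrightarrow> ideal I R \<and> radical R I = I"

definition ISP_domain :: "('a, 'm) ring_scheme \<Rightarrow> 'a set \<Rightarrow> bool" where
  "ISP_domain K A \<longleftrightarrow> is_quotient_field K A \<and>
     (\<forall>I. ideal I (K\<lparr>carrier := A\<rparr>) \<and> I \<noteq> A \<and> I \<noteq> {\<zero>\<^bsub>K\<^esub>} \<longrightarrow>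
        (\<exists>J Qs. invertible_ideal K A J \<and> Qs \<noteq> [] \<and>
           (\<forall>Q\<in>set Qs. radical_ideal (K\<lparr>carrier := A\<rparr>) Q \<and> Q \<noteq> A) \<and>
           I = foldl (ideal_prod (K\<lparr>carrier := A\<rparr>)) J Qs))"

end

theory Submission
  imports Defs
begin

text \<open>
  For a flat overring \<open>B\<close> of \<open>A\<close>, every \<open>x \<in> B\<close> satisfies \<open>(A : x) B = B\<close>: the element
  \<open>1 \<otimes> x - x \<otimes> 1\<close> of \<open>(A + A x) \<otimes> B\<close> vanishes in \<open>K \<otimes> B\<close>, hence vanishes, and the map
  \<open>(c + d x) \<otimes> b \<mapsto> d b\<close> into \<open>B / (A : x) B\<close> sends it to \<open>-1\<close>. It follows that
  \<open>(I \<inter> A) B = I\<close> for every ideal \<open>I\<close> of \<open>B\<close>, and that extension to \<open>B\<close> preserves radical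
  ideals, as it does products and invertible ideals. So a factorization
  \<open>I \<inter> A = J Q\<^sub>1 \<cdots> Q\<^sub>n\<close> extends to one of \<open>I\<close>, from which the factors \<open>Q\<^sub>i B = B\<close> can be
  dropped; one factor at least remains, because otherwise \<open>J \<subseteq> I \<inter> A = J Q\<^sub>1 \<cdots> Q\<^sub>n\<close>, which
  is impossible for an invertible \<open>J\<close>.
\<close>

subsection \<open>Products of submodules of a ring\<close>

text \<open>The rules generating \<open>ideal_prod\<close> refer to addition and multiplication
  alone, so ideals of \<open>A\<close> and of \<open>B\<close> can be multiplied in one ambient
  ring.\<close>

lemma ideal_prod_carrier_update [simp]:
  "ideal_prod (K\<lparr>carrier := A\<rparr>) I J = ideal_prod K I J"
proof -
  have "x \<in> ideal_prod K I J" if "x \<in> ideal_prod (K\<lparr>carrier := A\<rparr>) I J" for x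
    using that by induction (auto intro: ideal_prod.intros)
  moreover have "x \<in> ideal_prod (K\<lparr>carrier := A\<rparr>) I J" if "x \<in> ideal_prod K I J" for x
    using that
  proof induction
    case (prod i j)
    then show ?case using ideal_prod.prod[of i I j J "K\<lparr>carrier := A\<rparr>"] by simp
  next
    case (sum s t)
    then show ?case using ideal_prod.sum[of s "K\<lparr>carrier := A\<rparr>" I J t] by simp
  qed
  ultimately show ?thesis by blast
qed

lemma ideal_prod_mono:
  assumes "I \<subseteq> I'" "J \<subseteq> J'"
  shows "ideal_prod K I J \<subseteq> ideal_prod K I' J'"
proof
  fix x assume "x \<in> ideal_prod K I J"
  then show "x \<in> ideal_prod K I' J'"
    by induction (use assms in \<open>auto intro: ideal_prod.intros\<close>)
qed

lemma ideal_prod_least: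
  assumes "\<And>i j. i \<in> I \<Longrightarrow> j \<in> J \<Longrightarrow> i \<otimes>\<^bsub>K\<^esub> j \<in> S"
    and "\<And>x y. x \<in> S \<Longrightarrow> y \<in> S \<Longrightarrow> x \<oplus>\<^bsub>K\<^esub> y \<in> S"
  shows "ideal_prod K I J \<subseteq> S"
proof
  fix x assume "x \<in> ideal_prod K I J"
  then show "x \<in> S" by induction (use assms in auto)
qed

context cring
begin

lemma ideal_prod_closed:
  assumes "I \<subseteq> carrier R" "J \<subseteq> carrier R"
  shows "I \<cdot> J \<subseteq> carrier R"
  by (rule ideal_prod_least) (use assms in auto)

lemma ideal_prod_comm:
  assumes "I \<subseteq> carrier R" "J \<subseteq> carrier R"
  shows "I \<cdot> J = J \<cdot> I"
proof -
  have "I \<cdot> J \<subseteq> J \<cdot> I" if "I \<subseteq> carrier R" "J \<subseteq> carrier R" for I J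
  proof (rule ideal_prod_least)
    fix i j assume "i \<in> I" "j \<in> J"
    then have "j \<otimes> i \<in> J \<cdot> I" "j \<otimes> i = i \<otimes> j"
      using that m_comm by (auto intro: ideal_prod.intros)
    then show "i \<otimes> j \<in> J \<cdot> I" by simp
  qed (auto intro: ideal_prod.intros)
  then show ?thesis using assms by blast
qed

text \<open>By commutativity a factor \<open>x\<close> can be moved into the left factor of every
  summand. This one computation yields associativity, the scalar action on products, and the passage
  from \<open>\<one> \<in> C \<cdot> B\<close> to \<open>x \<in> L \<cdot> B\<close>.\<close>

lemma mult_mem_ideal_prod:
  assumes "x \<in> carrier R" "J \<subseteq> carrier R" "C \<subseteq> carrier R" "z \<in> J \<cdot> C"
    and "\<And>j. j \<in> J \<Longrightarrow> j \<otimes> x \<in> L"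
  shows "z \<otimes> x \<in> L \<cdot> C"
  using assms(4)
proof induction
  case (prod j c)
  then have "j \<otimes> c \<otimes> x = j \<otimes> x \<otimes> c"
    using assms by (simp add: m_ac subset_iff)
  then show ?case using prod assms by (auto intro: ideal_prod.intros)
next
  case (sum s t)
  then have "s \<in> carrier R" "t \<in> carrier R"
    using ideal_prod_closed assms by blast+
  then show ?case using sum assms by (auto simp: l_distr intro: ideal_prod.intros)
qed

text \<open>One inclusion, proved for all triples, is enough: by commutativity its instance for the
  reversed triple is the converse.\<close>

lemma ideal_prod_assoc:
  assumes "I \<subseteq> carrier R" "J \<subseteq> carrier R" "L \<subseteq> carrier R"
  shows "(I \<cdot> J) \<cdot> L = I \<cdot> (J \<cdot> L)"
proof -
  have *: "(I \<cdot> J) \<cdot> L \<subseteq> I \<cdot> (J \<cdot> L)"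
    if c: "I \<subseteq> carrier R" "J \<subseteq> carrier R" "L \<subseteq> carrier R" for I J L
  proof (rule ideal_prod_least)
    fix z l assume z: "z \<in> I \<cdot> J" and l: "l \<in> L"
    have "z \<in> J \<cdot> I" using z c by (simp add: ideal_prod_comm)
    then have "z \<otimes> l \<in> (J \<cdot> L) \<cdot> I"
      using c l by (intro mult_mem_ideal_prod[of l J I z]) (auto intro: ideal_prod.intros)
    then show "z \<otimes> l \<in> I \<cdot> (J \<cdot> L)"
      using ideal_prod_comm[of "J \<cdot> L" I] ideal_prod_closed[of J L] c by simp
  qed (auto intro: ideal_prod.intros)
  have "I \<cdot> (J \<cdot> L) = (L \<cdot> J) \<cdot> I"
    using ideal_prod_comm ideal_prod_closed assms by metis
  also have "\<dots> \<subseteq> L \<cdot> (J \<cdot> I)" using * assms by blast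
  also have "\<dots> = (I \<cdot> J) \<cdot> L"
    using ideal_prod_comm ideal_prod_closed assms by metis
  finally show ?thesis using * assms by blast
qed

text \<open>For a subring \<open>A\<close> this says that \<open>I\<close> is an \<open>A\<close>-submodule; closure under negation
  comes from multiplication by \<open>-1\<close>.\<close>

definition submod :: "'a set \<Rightarrow> 'a set \<Rightarrow> bool" where
  "submod A I \<longleftrightarrow> I \<subseteq> carrier R \<and> \<zero> \<in> I \<and> (\<forall>x\<in>I. \<forall>y\<in>I. x \<oplus> y \<in> I) \<and>
     (\<forall>a\<in>A. \<forall>x\<in>I. a \<otimes> x \<in> I)"

lemma submodD:
  assumes "submod A I"
  shows "I \<subseteq> carrier R" "\<zero> \<in> I" "\<And>x y. x \<in> I \<Longrightarrow> y \<in> I \<Longrightarrow> x \<oplus> y \<in> I"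
    "\<And>a x. a \<in> A \<Longrightarrow> x \<in> I \<Longrightarrow> a \<otimes> x \<in> I"
  using assms unfolding submod_def by auto

lemma submod_uminus:
  assumes "subring A R" "submod A I" "x \<in> I"
  shows "\<ominus> x \<in> I"
proof -
  have "(\<ominus> \<one>) \<otimes> x \<in> I"
    using assms subringE(3,5) submodD(4) by metis
  moreover have "(\<ominus> \<one>) \<otimes> x = \<ominus> x"
    using assms submodD(1) by (simp add: l_minus subset_iff)
  ultimately show ?thesis by simp
qed

lemma submod_iff_additive_subgroup:
  assumes "subring A R"
  shows "submod A I \<longleftrightarrow> additive_subgroup I R \<and> (\<forall>a\<in>A. \<forall>x\<in>I. a \<otimes> x \<in> I)"
proof
  assume I: "submod A I"
  have "subgroup I (add_monoid R)"
    using I assms submod_uminus[OF assms I]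
    by (intro add.subgroupI) (auto simp: submod_def a_inv_def)
  then show "additive_subgroup I R \<and> (\<forall>a\<in>A. \<forall>x\<in>I. a \<otimes> x \<in> I)"
    using I by (auto simp: submod_def additive_subgroup_def)
qed (auto simp: submod_def additive_subgroup.a_Hcarr additive_subgroup.zero_closed
       additive_subgroup.a_closed)

text \<open>Ideals of different subrings thus become submodules of the same ring, and the lemmas on
  \<open>submod\<close> apply to all of them.\<close>

lemma ideal_iff_submod:
  assumes A: "subring A R"
  shows "ideal I (R\<lparr>carrier := A\<rparr>) \<longleftrightarrow> submod A I \<and> I \<subseteq> A"
proof
  assume I: "ideal I (R\<lparr>carrier := A\<rparr>)"
  note add = ideal.axioms(1)[OF I]
  have "I \<subseteq> A" using additive_subgroup.a_subset[OF add] by simp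
  then show "submod A I \<and> I \<subseteq> A"
    using subringE(1)[OF A] additive_subgroup.zero_closed[OF add]
      additive_subgroup.a_closed[OF add] ideal.I_l_closed[OF I] by (auto simp: submod_def)
next
  assume I: "submod A I \<and> I \<subseteq> A"
  then have "subgroup I (add_monoid R)"
    using submod_iff_additive_subgroup[OF A] additive_subgroup.a_subgroup by blast
  moreover have "subgroup A (add_monoid R)"
    using A by (simp add: subring.axioms(1))
  ultimately have "subgroup I (add_monoid (R\<lparr>carrier := A\<rparr>))"
    using I add.subgroup_incl[of I A] by simp
  moreover have "x \<otimes> a \<in> I" "a \<otimes> x \<in> I" if "a \<in> I" "x \<in> A" for a x
    using that I submodD(4)[of A I] subringE(1)[OF A] by (blast, metis m_comm subsetD)
  ultimately show "ideal I (R\<lparr>carrier := A\<rparr>)"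
    by (intro idealI) (simp_all add: subring_is_ring[OF A])
qed

lemma submod_subring: "subring A R \<Longrightarrow> A \<subseteq> B \<Longrightarrow> subring B R \<Longrightarrow> submod A B"
  using subringE[of B R] by (auto simp: submod_def)

lemma submod_inter: "submod A I \<Longrightarrow> submod A J \<Longrightarrow> submod A (I \<inter> J)"
  by (auto simp: submod_def)

lemma submod_antimono: "submod B I \<Longrightarrow> A \<subseteq> B \<Longrightarrow> submod A I"
  by (auto simp: submod_def)

text \<open>Scalars are absorbed by the left factor. A member of \<open>J\<close> is required to
  produce zero as a product, since \<open>ideal_prod\<close> has no rule for the empty sum.\<close>

lemma submod_prod:
  assumes A: "A \<subseteq> carrier R" and I: "submod A I" and J: "J \<subseteq> carrier R" "J \<noteq> {}"
  shows "submod A (I \<cdot> J)"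
proof -
  have c: "I \<cdot> J \<subseteq> carrier R" using I J submodD(1) ideal_prod_closed by metis
  obtain j where "j \<in> J" using J by blast
  then have "\<zero> \<otimes> j \<in> I \<cdot> J" using submodD(2)[OF I] by (auto intro: ideal_prod.intros)
  then have "\<zero> \<in> I \<cdot> J" using \<open>j \<in> J\<close> J by (simp add: subset_iff)
  moreover have "a \<otimes> x \<in> I \<cdot> J" if "a \<in> A" "x \<in> I \<cdot> J" for a x
  proof -
    have "x \<otimes> a \<in> I \<cdot> J"
      using that A I J m_comm
      by (intro mult_mem_ideal_prod[of a I J x I]) (auto simp: submod_def subset_iff)
    then show ?thesis using that A c m_comm by (metis subsetD)
  qed
  ultimately show ?thesis using c by (auto simp: submod_def intro: ideal_prod.intros)
qed

lemma submod_prod_right: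
  assumes "A \<subseteq> carrier R" "submod A J" "I \<subseteq> carrier R" "I \<noteq> {}"
  shows "submod A (I \<cdot> J)"
  using submod_prod[OF assms] ideal_prod_comm[of I J] assms submodD(1) by metis

lemma submod_prod_subring:
  assumes A: "subring A R" and I: "submod A I"
  shows "I \<cdot> A = I"
proof
  note c = subringE(1)[OF A] submodD(1)[OF I]
  show "I \<cdot> A \<subseteq> I"
  proof (rule ideal_prod_least)
    fix i a assume "i \<in> I" "a \<in> A"
    then have "a \<otimes> i \<in> I" "a \<otimes> i = i \<otimes> a"
      using submodD(4)[OF I] c by (blast, metis m_comm subsetD)
    then show "i \<otimes> a \<in> I" by simp
  qed (use submodD(3)[OF I] in auto)
  show "I \<subseteq> I \<cdot> A"
  proof
    fix x assume "x \<in> I"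
    then have "x \<otimes> \<one> \<in> I \<cdot> A" using subringE(3)[OF A] by (auto intro: ideal_prod.intros)
    then show "x \<in> I \<cdot> A" using \<open>x \<in> I\<close> c by (simp add: subset_iff)
  qed
qed

lemma submod_subring_self: "subring A R \<Longrightarrow> submod A A"
  by (simp add: submod_subring)

lemma prod_subset_left:
  assumes A: "subring A R" and I: "submod A I" and J: "J \<subseteq> A"
  shows "I \<cdot> J \<subseteq> I"
  using ideal_prod_mono[OF subset_refl J] submod_prod_subring[OF A I] by metis

lemma prod_subset_right:
  assumes A: "subring A R" and J: "submod A J" and I: "I \<subseteq> A"
  shows "I \<cdot> J \<subseteq> J"
  using prod_subset_left[OF assms] ideal_prod_comm[of I J] assms submodD(1) subringE(1)
  by (metis subset_trans)

text \<open>After reordering the factors, the reason is \<open>B \<cdot> B = B\<close>.\<close>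

lemma extension_prod:
  assumes "subring B R" "I \<subseteq> carrier R" "J \<subseteq> carrier R"
  shows "(I \<cdot> J) \<cdot> B = (I \<cdot> B) \<cdot> (J \<cdot> B)"
proof -
  note c = assms(2,3) subringE(1)[OF assms(1)]
  have "(I \<cdot> B) \<cdot> (J \<cdot> B) = I \<cdot> (B \<cdot> (J \<cdot> B))"
    using c by (simp add: ideal_prod_assoc ideal_prod_closed)
  also have "B \<cdot> (J \<cdot> B) = (J \<cdot> B) \<cdot> B"
    using c by (simp add: ideal_prod_comm ideal_prod_closed)
  also have "\<dots> = J \<cdot> B"
    using c submod_prod_subring[OF assms(1) submod_subring_self[OF assms(1)]]
    by (simp add: ideal_prod_assoc)
  finally show ?thesis using c by (simp add: ideal_prod_assoc)
qed

lemma one_mem_submod: "submod A I \<Longrightarrow> A \<subseteq> carrier R \<Longrightarrow> \<one> \<in> I \<Longrightarrow> A \<subseteq> I"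
  using submodD(4)[of A I _ \<one>] by (fastforce simp: subset_iff)

lemma extension_foldl:
  assumes B: "subring B R" and "J \<subseteq> carrier R" "\<forall>Q\<in>set Qs. Q \<subseteq> carrier R"
  shows "foldl (ideal_prod R) J Qs \<cdot> B = foldl (ideal_prod R) (J \<cdot> B) (map (\<lambda>Q. Q \<cdot> B) Qs)"
  using assms(2,3)
  by (induction Qs arbitrary: J) (simp_all add: extension_prod[OF B] ideal_prod_closed)

text \<open>\<open>B\<close> is neutral for multiplication of \<open>B\<close>-submodules.\<close>

lemma foldl_filter_unit:
  assumes B: "subring B R" and "submod B J" "\<forall>Q\<in>set Qs. submod B Q"
  shows "foldl (ideal_prod R) J (filter (\<lambda>Q. Q \<noteq> B) Qs) = foldl (ideal_prod R) J Qs"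
  using assms(2,3)
proof (induction Qs arbitrary: J)
  case (Cons Q Qs)
  then have "submod B (J \<cdot> Q)"
    using subringE(1)[OF B] by (intro submod_prod) (auto simp: submod_def)
  then show ?case using Cons submod_prod_subring[OF B] by auto
qed simp

lemma foldl_subset:
  assumes A: "subring A R" and "submod A J" "\<forall>Q\<in>set Qs. submod A Q \<and> Q \<subseteq> A"
  shows "foldl (ideal_prod R) J Qs \<subseteq> J"
  using assms(2,3)
proof (induction Qs arbitrary: J)
  case (Cons Q Qs)
  then have "submod A (J \<cdot> Q)"
    using subringE(1)[OF A] by (intro submod_prod) (auto simp: submod_def)
  then have "foldl (ideal_prod R) J (Q # Qs) \<subseteq> J \<cdot> Q" using Cons by simp
  also have "\<dots> \<subseteq> J" using prod_subset_left[OF A] Cons by simp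
  finally show ?case .
qed simp

subsection \<open>Extension of ideals to a flat overring\<close>

text \<open>This is the ideal quotient \<open>(Q : x)\<close> taken inside \<open>A\<close>; for
  \<open>Q = A\<close> it consists of the denominators of \<open>x\<close> in the usual
  sense.\<close>

definition denominators :: "'a set \<Rightarrow> 'a set \<Rightarrow> 'a \<Rightarrow> 'a set" where
  "denominators A Q x = {a \<in> A. a \<otimes> x \<in> Q}"

lemma submod_denominators:
  assumes A: "subring A R" and Q: "submod A Q" and x: "x \<in> carrier R"
  shows "submod A (denominators A Q x)"
proof -
  have c: "a \<in> carrier R" if "a \<in> A" for a using that subringE(1)[OF A] by blast
  show ?thesis
    using submodD[OF Q] x subringE[OF A] c
    by (auto simp: submod_def denominators_def l_distr m_assoc)
qed

text \<open>The assumption \<open>dense\<close> says \<open>(A : x) B = B\<close> for all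
  \<open>x\<close> in \<open>B\<close>. Flatness enters the arguments of this context only in this
  form.\<close>

context
  fixes A B
  assumes A: "subring A R" and B: "subring B R" and AB: "A \<subseteq> B"
    and dense: "\<And>x. x \<in> B \<Longrightarrow> \<one> \<in> denominators A A x \<cdot> B"
begin

lemma carriers: "A \<subseteq> carrier R" "B \<subseteq> carrier R"
  using subringE(1) A B by auto

text \<open>Subsets of \<open>A\<close> that generate the unit ideal of \<open>B\<close> are closed
  under products, so several conditions on a denominator can be imposed at once.\<close>

lemma one_mem_prod_extension:
  assumes "C \<subseteq> A" "D \<subseteq> A" "\<one> \<in> C \<cdot> B" "\<one> \<in> D \<cdot> B"
  shows "\<one> \<in> (C \<cdot> D) \<cdot> B"
proof -
  have "\<one> \<otimes> \<one> \<in> (C \<cdot> B) \<cdot> (D \<cdot> B)" using assms by (blast intro: ideal_prod.intros)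
  then show ?thesis using extension_prod[OF B, of C D] assms carriers by simp
qed

text \<open>Writing 1 as a sum of products \<open>c b\<close> with \<open>c\<close> in
  \<open>C\<close> and \<open>b\<close> in \<open>B\<close>, and multiplying by \<open>x\<close>,
  exhibits \<open>x\<close> as a sum of the products \<open>(c x) b\<close>.\<close>

lemma mem_extension:
  assumes C: "C \<subseteq> A" "\<one> \<in> C \<cdot> B" and x: "x \<in> carrier R" and L: "\<And>c. c \<in> C \<Longrightarrow> c \<otimes> x \<in> L"
  shows "x \<in> L \<cdot> B"
  using mult_mem_ideal_prod[of x C B \<one> L] assms carriers by (auto simp: subset_iff)

text \<open>Induction on the representation of \<open>y\<close>: a denominator of \<open>b\<close>
  carries \<open>q b\<close> into \<open>Q\<close>, and for a sum the product of the two denominator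
  ideals works for both summands.\<close>

lemma one_mem_denominators_extension:
  assumes Q: "submod A Q" "Q \<subseteq> A" and "y \<in> Q \<cdot> B"
  shows "\<one> \<in> denominators A Q y \<cdot> B"
  using assms(3)
proof induction
  case (prod q b)
  have "denominators A A b \<subseteq> denominators A Q (q \<otimes> b)"
  proof
    fix a assume a: "a \<in> denominators A A b"
    then have "a \<in> carrier R" "q \<in> carrier R" "b \<in> carrier R"
      using prod Q carriers by (auto simp: denominators_def)
    then have "a \<otimes> (q \<otimes> b) = (a \<otimes> b) \<otimes> q" by (simp add: m_ac)
    then show "a \<in> denominators A Q (q \<otimes> b)"
      using a prod submodD(4)[OF Q(1)] by (auto simp: denominators_def)
  qed
  then show ?case
    using dense[OF prod(2)] ideal_prod_mono[of _ _ B B] by blast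
next
  case (sum s t)
  have c: "s \<in> carrier R" "t \<in> carrier R"
    using sum.hyps ideal_prod_closed[of Q B] carriers submodD(1)[OF Q(1)] by blast+
  let ?C = "denominators A Q s" and ?D = "denominators A Q t"
  have sub: "?C \<subseteq> A" "?D \<subseteq> A" by (auto simp: denominators_def)
  have "?C \<cdot> ?D \<subseteq> ?C \<inter> ?D"
    using prod_subset_left[OF A submod_denominators[OF A Q(1) c(1)] sub(2)]
      prod_subset_right[OF A submod_denominators[OF A Q(1) c(2)] sub(1)] by blast
  also have "\<dots> \<subseteq> denominators A Q (s \<oplus> t)"
    using c carriers submodD(3)[OF Q(1)] by (auto simp: denominators_def r_distr subset_iff)
  finally show ?case
    using one_mem_prod_extension[OF sub sum.IH] ideal_prod_mono[of _ _ B B] by blast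
qed

text \<open>For \<open>x\<close> in \<open>I\<close>, every denominator \<open>c\<close> of
  \<open>x\<close> gives \<open>c x\<close> in \<open>I \<inter> A\<close>, and these denominators
  generate the unit ideal of \<open>B\<close>.\<close>

lemma extension_contraction:
  assumes I: "submod B I" "I \<subseteq> B"
  shows "(I \<inter> A) \<cdot> B = I"
proof
  show "(I \<inter> A) \<cdot> B \<subseteq> I"
    using ideal_prod_mono[of "I \<inter> A" I B B] submod_prod_subring[OF B I(1)] by auto
  show "I \<subseteq> (I \<inter> A) \<cdot> B"
  proof
    fix x assume x: "x \<in> I"
    then have "c \<otimes> x \<in> I \<inter> A" if "c \<in> denominators A A x" for c
      using that submodD(4)[OF I(1)] AB by (auto simp: denominators_def)
    moreover have "denominators A A x \<subseteq> A" by (auto simp: denominators_def)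
    moreover have "\<one> \<in> denominators A A x \<cdot> B" "x \<in> carrier R"
      using dense x I carriers by blast+
    ultimately show "x \<in> (I \<inter> A) \<cdot> B" by (blast intro: mem_extension)
  qed
qed

lemma submod_extension: "submod A I \<Longrightarrow> submod B (I \<cdot> B)"
  using submod_prod_right[OF carriers(2) submod_subring_self[OF B], of I] submodD(1,2)
  by blast

lemma extension_subset: "I \<subseteq> A \<Longrightarrow> I \<cdot> B \<subseteq> B"
  using prod_subset_right[OF B submod_subring_self[OF B]] AB by blast

lemma ideal_extension:
  "ideal I (R\<lparr>carrier := A\<rparr>) \<Longrightarrow> ideal (I \<cdot> B) (R\<lparr>carrier := B\<rparr>)"
  by (simp add: ideal_iff_submod A B submod_extension extension_subset)

lemma nat_pow_subring: "x [^]\<^bsub>R\<lparr>carrier := S\<rparr>\<^esub> (n::nat) = x [^] n"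
  by (metis nat_pow_consistent)

text \<open>Let \<open>x^n\<close> lie in \<open>Q B\<close>. If \<open>c\<close> carries
  \<open>x^n\<close> into \<open>Q\<close> and \<open>x\<close> into \<open>A\<close>, then
  \<open>(c x)^n = c^(n-1) (c x^n)\<close> is in \<open>Q\<close>, hence so is \<open>c x\<close>,
  as \<open>Q\<close> is radical. Enough such \<open>c\<close> exist to generate the unit ideal of
  \<open>B\<close>, so \<open>x\<close> is in \<open>Q B\<close>.\<close>

lemma radical_ideal_extension:
  assumes "radical_ideal (R\<lparr>carrier := A\<rparr>) Q"
  shows "radical_ideal (R\<lparr>carrier := B\<rparr>) (Q \<cdot> B)"
proof -
  have idl: "ideal Q (R\<lparr>carrier := A\<rparr>)" and rad: "radical (R\<lparr>carrier := A\<rparr>) Q = Q"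
    using assms by (auto simp: radical_ideal_def)
  have Q: "submod A Q" "Q \<subseteq> A" using idl ideal_iff_submod[OF A] by auto
  have QB: "Q \<cdot> B \<subseteq> B" using extension_subset Q by blast
  have "x \<in> Q \<cdot> B" if x: "x \<in> B" and n: "n \<ge> 1" "x [^] n \<in> Q \<cdot> B" for x and n :: nat
  proof -
    let ?C = "denominators A Q (x [^] n)" and ?D = "denominators A A x"
    have xc: "x \<in> carrier R" using x carriers by blast
    have sub: "?C \<subseteq> A" "?D \<subseteq> A" by (auto simp: denominators_def)
    have "c \<otimes> x \<in> Q" if "c \<in> ?C \<cdot> ?D" for c
    proof -
      have "?C \<cdot> ?D \<subseteq> ?C \<inter> ?D"
        using prod_subset_left[OF A submod_denominators[OF A Q(1)] sub(2)]
          prod_subset_right[OF A submod_denominators[OF A submod_subring_self[OF A]] sub(1)] xc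
        by blast
      then have c: "c \<in> A" "c \<otimes> x [^] n \<in> Q" "c \<otimes> x \<in> A"
        using that by (auto simp: denominators_def)
      then have cc: "c \<in> carrier R" using carriers by blast
      obtain m where m: "n = Suc m" using n(1) by (cases n) auto
      have "c [^] m \<in> A"
        using c(1) by (induction m) (auto simp: subringE[OF A])
      then have "c [^] m \<otimes> (c \<otimes> x [^] n) \<in> Q" using c submodD(4)[OF Q(1)] by blast
      moreover have "c [^] m \<otimes> (c \<otimes> x [^] n) = (c \<otimes> x) [^] n"
        using cc xc by (simp add: nat_pow_distrib m m_ac)
      ultimately have "c \<otimes> x \<in> radical (R\<lparr>carrier := A\<rparr>) Q"
        using c n(1) by (auto simp: radical_def nat_pow_subring)
      then show ?thesis using rad by simp
    qed
    moreover have "?C \<cdot> ?D \<subseteq> A"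
      using prod_subset_left[OF A submod_subring_self[OF A] sub(2)]
        ideal_prod_mono[OF sub(1) subset_refl] by blast
    ultimately show ?thesis
      using mem_extension[OF _ one_mem_prod_extension[OF sub]] xc
        one_mem_denominators_extension[OF Q n(2)] dense[OF x] by blast
  qed
  moreover have "x \<in> radical (R\<lparr>carrier := B\<rparr>) (Q \<cdot> B)" if "x \<in> Q \<cdot> B" for x
    using that QB carriers
    by (auto simp: radical_def nat_pow_subring subset_iff intro!: exI[of _ "1::nat"])
  ultimately have "radical (R\<lparr>carrier := B\<rparr>) (Q \<cdot> B) = Q \<cdot> B"
    by (auto simp: radical_def nat_pow_subring)
  then show ?thesis using ideal_extension[OF idl] by (simp add: radical_ideal_def)
qed

text \<open>The inverse of \<open>J B\<close> is \<open>J' B\<close>, and a common denominator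
  \<open>d\<close> of \<open>J'\<close> over \<open>A\<close> remains one of \<open>J' B\<close>
  over \<open>B\<close>.\<close>

lemma invertible_ideal_extension:
  assumes "invertible_ideal R A J"
  shows "invertible_ideal R B (J \<cdot> B)"
proof -
  obtain J' d where J: "ideal J (R\<lparr>carrier := A\<rparr>)" and inv: "J \<cdot> J' = A"
    and J': "additive_subgroup J' R" "\<forall>a\<in>A. \<forall>x\<in>J'. a \<otimes> x \<in> J'"
    and d: "d \<in> A - {\<zero>}" "\<forall>x\<in>J'. d \<otimes> x \<in> A"
    using assms unfolding invertible_ideal_def fractional_ideal_def by blast
  have sm: "submod A J" "submod A J'"
    using J J' ideal_iff_submod[OF A] submod_iff_additive_subgroup[OF A] by auto
  note c = submodD(1)[OF sm(1)] submodD(1)[OF sm(2)]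
  have "(J \<cdot> B) \<cdot> (J' \<cdot> B) = A \<cdot> B" using extension_prod[OF B c] inv by simp
  also have "\<dots> = B"
    using submod_prod_subring[OF A submod_subring[OF A AB B]] ideal_prod_comm carriers by metis
  finally have "(J \<cdot> B) \<cdot> (J' \<cdot> B) = B" .
  moreover have "d \<otimes> x \<in> B" if "x \<in> J' \<cdot> B" for x
  proof -
    have dc: "d \<in> carrier R" using d carriers by blast
    have "x \<otimes> d \<in> A \<cdot> B"
      using that c carriers d dc m_comm
      by (intro mult_mem_ideal_prod[of d J' B x A]) (auto simp: subset_iff)
    then show ?thesis
      using \<open>A \<cdot> B = B\<close> m_comm[OF dc] ideal_prod_closed[OF c(2) carriers(2)] that by auto
  qed
  ultimately show ?thesis
    using ideal_extension[OF J] submod_extension[OF sm(2)] submod_iff_additive_subgroup[OF B] d(1) AB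
    unfolding invertible_ideal_def fractional_ideal_def by blast
qed

end

text \<open>Multiply the inclusion by the inverse of \<open>J\<close>. For a proper ideal
  \<open>Q\<close> of \<open>A\<close> this excludes
  \<open>J \<subseteq> J \<cdot> Q\<close>.\<close>

lemma invertible_ideal_cancel:
  assumes A: "subring A R" and J: "invertible_ideal R A J" and Q: "submod A Q" "J \<subseteq> J \<cdot> Q"
  shows "A \<subseteq> Q"
proof -
  obtain J' where inv: "J \<cdot> J' = A" "fractional_ideal R A J'"
    and J: "ideal J (R\<lparr>carrier := A\<rparr>)"
    using J unfolding invertible_ideal_def by blast
  have sm: "submod A J" "submod A J'"
    using J inv ideal_iff_submod[OF A] submod_iff_additive_subgroup[OF A]
    by (auto simp: fractional_ideal_def)
  note c = submodD(1)[OF sm(1)] submodD(1)[OF sm(2)] submodD(1)[OF Q(1)]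
  have "A = J' \<cdot> J" using inv c ideal_prod_comm by blast
  also have "\<dots> \<subseteq> J' \<cdot> (J \<cdot> Q)" using Q ideal_prod_mono by blast
  also have "\<dots> = (J' \<cdot> J) \<cdot> Q" using c by (simp add: ideal_prod_assoc)
  also have "\<dots> = A \<cdot> Q" using \<open>A = J' \<cdot> J\<close> by simp
  also have "\<dots> \<subseteq> Q" using prod_subset_right[OF A Q(1)] by blast
  finally show ?thesis .
qed

end

subsection \<open>Tensor relations and flatness\<close>

lemma tensor_relations_carrier:
  assumes "module R M" "module R N"
  shows "tensor_relations R M N \<subseteq> carrier (free_Abelian_group (carrier M \<times> carrier N))"
proof -
  let ?F = "free_Abelian_group (carrier M \<times> carrier N)"
  have M: "abelian_group M" and N: "abelian_group N"
    using assms by (auto simp: module_def)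
  have diff: "u - v \<in> carrier ?F" if "u \<in> carrier ?F" "v \<in> carrier ?F" for u v
    using that keys_diff[of u v] by auto
  show ?thesis
    unfolding tensor_relations_def
    by (auto intro!: diff simp del: carrier_free_Abelian_group_iff
        simp: abelian_monoid.a_closed abelian_group.axioms(1) M N
          module.smult_closed[OF assms(1)] module.smult_closed[OF assms(2)])
qed

lemma subgroup_tensor_subgroup:
  assumes "module R M" "module R N"
  shows "subgroup (tensor_subgroup R M N) (free_Abelian_group (carrier M \<times> carrier N))"
  unfolding tensor_subgroup_def
  by (intro group.generate_is_subgroup tensor_relations_carrier assms group_free_Abelian_group)

text \<open>Linearity of \<open>f\<close> takes each generating relation to a relation of the same
  kind, which makes \<open>f \<otimes> id\<close> well defined on cosets.\<close>

lemma frag_extend_tensor_subgroup: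
  assumes M: "module R M" and M': "module R M'" and N: "module R N"
    and f: "f \<in> module_hom R M M'" and t: "t \<in> tensor_subgroup R M N"
  shows "frag_extend (\<lambda>(x, n). frag_of (f x, n)) t \<in> tensor_subgroup R M' N"
proof -
  let ?e = "frag_extend (\<lambda>(x, n). frag_of (f x, n))"
  interpret S': subgroup "tensor_subgroup R M' N" "free_Abelian_group (carrier M' \<times> carrier N)"
    by (rule subgroup_tensor_subgroup[OF M' N])
  have rel: "?e h \<in> tensor_relations R M' N" if "h \<in> tensor_relations R M N" for h
    using that f unfolding tensor_relations_def module_hom_def
    by (auto simp: frag_extend_diff Pi_iff) blast+
  have rel': "?e h \<in> tensor_subgroup R M' N" if "h \<in> tensor_relations R M N" for h
    using rel[OF that] by (auto simp: tensor_subgroup_def intro: generate.incl)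
  show ?thesis using t unfolding tensor_subgroup_def[of R M N]
  proof induction
    case one
    then show ?case using S'.one_closed by simp
  next
    case (incl h)
    then show ?case using rel' by blast
  next
    case (inv h)
    then have "h \<in> carrier (free_Abelian_group (carrier M \<times> carrier N))"
      using tensor_relations_carrier[OF M N] by blast
    moreover have "?e h \<in> carrier (free_Abelian_group (carrier M' \<times> carrier N))"
      using rel'[OF inv] S'.subset by blast
    ultimately show ?case
      using S'.m_inv_closed[OF rel'[OF inv]] by (simp add: frag_extend_minus)
  next
    case (eng h1 h2)
    then show ?case using S'.m_closed[OF eng.IH] by (simp add: frag_extend_add)
  qed
qed

text \<open>Another representative of the coset is \<open>s + u\<close> with \<open>s\<close> in the
  relation subgroup, and \<open>e s\<close> is again in the relation subgroup. So the union in
  \<open>tensor_map\<close> is a union of copies of one coset.\<close>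

lemma tensor_map_coset:
  assumes M: "module R M" and M': "module R M'" and N: "module R N"
    and f: "f \<in> module_hom R M M'" and u: "u \<in> carrier (free_Abelian_group (carrier M \<times> carrier N))"
  defines "e \<equiv> frag_extend (\<lambda>(x, n). frag_of (f x, n))"
  shows "tensor_map R M' N f
      (tensor_subgroup R M N #>\<^bsub>free_Abelian_group (carrier M \<times> carrier N)\<^esub> u) =
    tensor_subgroup R M' N #>\<^bsub>free_Abelian_group (carrier M' \<times> carrier N)\<^esub> e u"
proof -
  let ?S = "tensor_subgroup R M N" and ?S' = "tensor_subgroup R M' N"
  let ?F = "free_Abelian_group (carrier M \<times> carrier N)"
  let ?F' = "free_Abelian_group (carrier M' \<times> carrier N)"
  interpret F: group ?F by simp
  interpret F': group ?F' by simp
  note S = subgroup_tensor_subgroup[OF M N] and S' = subgroup_tensor_subgroup[OF M' N]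
  have eu: "e u \<in> carrier ?F'"
  proof -
    have "\<And>x n. (x, n) \<in> Poly_Mapping.keys u \<Longrightarrow> f x \<in> carrier M' \<and> n \<in> carrier N"
      using u f by (auto simp: module_hom_def)
    then show ?thesis
      using keys_frag_extend[of "\<lambda>(x, n). frag_of (f x, n)" u]
      by (fastforce simp: e_def)
  qed
  have "?S' #>\<^bsub>?F'\<^esub> e t = ?S' #>\<^bsub>?F'\<^esub> e u" if t: "t \<in> ?S #>\<^bsub>?F\<^esub> u" for t
  proof -
    obtain s where s: "s \<in> ?S" "t = s + u" using t by (auto simp: r_coset_def)
    then have "e t = e s + e u" "e s \<in> ?S'"
      using frag_extend_tensor_subgroup[OF M M' N f] by (auto simp: e_def frag_extend_add)
    then have "e t \<in> ?S' #>\<^bsub>?F'\<^esub> e u" by (auto simp: r_coset_def)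
    then show ?thesis using F'.repr_independence eu S' by blast
  qed
  moreover have "u \<in> ?S #>\<^bsub>?F\<^esub> u" using F.rcos_self u S by blast
  ultimately show ?thesis unfolding tensor_map_def e_def by blast
qed

text \<open>Flatness for pure tensors, with equality in the tensor product expressed by differences
  in the relation subgroup: if \<open>f x \<otimes> n\<close> and \<open>f x' \<otimes> n'\<close>
  agree, so do \<open>x \<otimes> n\<close> and \<open>x' \<otimes> n'\<close>.\<close>

lemma flat_module_injective:
  fixes R :: "('a, 'm) ring_scheme" and M M' :: "('a, 'a) module"
  assumes N: "flat_module R N" and M: "module R M" and M': "module R M'"
    and f: "f \<in> module_hom R M M'" "inj_on f (carrier M)"
    and x: "x \<in> carrier M" "x' \<in> carrier M" and n: "n \<in> carrier N" "n' \<in> carrier N"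
    and eq: "frag_of (f x, n) - frag_of (f x', n') \<in> tensor_subgroup R M' N"
  shows "frag_of (x, n) - frag_of (x', n') \<in> tensor_subgroup R M N"
proof -
  let ?S = "tensor_subgroup R M N" and ?S' = "tensor_subgroup R M' N"
  let ?F = "free_Abelian_group (carrier M \<times> carrier N)"
  let ?F' = "free_Abelian_group (carrier M' \<times> carrier N)"
  interpret F: group ?F by simp
  interpret F': group ?F' by simp
  have Nm: "module R N" and inj: "inj_on (tensor_map R M' N f) (carrier (tensor_product R M N))"
    using N M M' f unfolding flat_module_def by auto
  note S = subgroup_tensor_subgroup[OF M Nm] and S' = subgroup_tensor_subgroup[OF M' Nm]
  let ?u = "frag_of (x, n)" and ?v = "frag_of (x', n')"
  have uv: "?u \<in> carrier ?F" "?v \<in> carrier ?F" using x n by auto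
  have fv: "frag_of (f x', n') \<in> carrier ?F'"
    using x n f by (auto simp: module_hom_def)
  have "frag_of (f x, n) \<in> ?S' #>\<^bsub>?F'\<^esub> frag_of (f x', n')"
    using eq unfolding r_coset_def by force
  then have "?S' #>\<^bsub>?F'\<^esub> frag_of (f x', n') = ?S' #>\<^bsub>?F'\<^esub> frag_of (f x, n)"
    using F'.repr_independence fv S' by blast
  then have "tensor_map R M' N f (?S #>\<^bsub>?F\<^esub> ?u) = tensor_map R M' N f (?S #>\<^bsub>?F\<^esub> ?v)"
    using tensor_map_coset[OF M M' Nm f(1)] uv by simp
  moreover have "?S #>\<^bsub>?F\<^esub> ?u \<in> carrier (tensor_product R M N)"
    "?S #>\<^bsub>?F\<^esub> ?v \<in> carrier (tensor_product R M N)"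
    using uv by (auto simp only: tensor_product_def carrier_FactGroup)
  ultimately have "?S #>\<^bsub>?F\<^esub> ?u = ?S #>\<^bsub>?F\<^esub> ?v"
    using inj by (blast dest: inj_onD)
  then have "?u \<in> ?S #>\<^bsub>?F\<^esub> ?v" using F.rcos_self uv S by blast
  then show ?thesis by (auto simp: r_coset_def)
qed

text \<open>This is the universal property of the tensor product for maps into \<open>G / H\<close>.
  The map is given by representatives \<open>\<beta>\<close> in \<open>G\<close> that are biadditive
  and balanced modulo \<open>H\<close>, so no quotient has to be formed.\<close>

lemma (in abelian_group) tensor_subgroup_balanced:
  assumes M: "module A M" and N: "module A N" and H: "additive_subgroup H G"
    and \<beta>: "\<And>x n. x \<in> carrier M \<Longrightarrow> n \<in> carrier N \<Longrightarrow> \<beta> (x, n) \<in> carrier G"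
    and add_left: "\<And>x y n. x \<in> carrier M \<Longrightarrow> y \<in> carrier M \<Longrightarrow> n \<in> carrier N \<Longrightarrow>
      \<beta> (x \<oplus>\<^bsub>M\<^esub> y, n) \<ominus> \<beta> (x, n) \<ominus> \<beta> (y, n) \<in> H"
    and add_right: "\<And>x m n. x \<in> carrier M \<Longrightarrow> m \<in> carrier N \<Longrightarrow> n \<in> carrier N \<Longrightarrow>
      \<beta> (x, m \<oplus>\<^bsub>N\<^esub> n) \<ominus> \<beta> (x, m) \<ominus> \<beta> (x, n) \<in> H"
    and balanced: "\<And>r x n. r \<in> carrier A \<Longrightarrow> x \<in> carrier M \<Longrightarrow> n \<in> carrier N \<Longrightarrow>
      \<beta> (r \<odot>\<^bsub>M\<^esub> x, n) \<ominus> \<beta> (x, r \<odot>\<^bsub>N\<^esub> n) \<in> H"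
    and x: "x \<in> carrier M" "x' \<in> carrier M" "n \<in> carrier N" "n' \<in> carrier N"
    and t: "frag_of (x, n) - frag_of (x', n') \<in> tensor_subgroup A M N"
  shows "\<beta> (x, n) \<ominus> \<beta> (x', n') \<in> H"
proof -
  let ?P = "carrier M \<times> carrier N"
  let ?F = "free_Abelian_group ?P"
  interpret M: module A M by fact
  interpret N: module A N by fact
  interpret H: subgroup H "add_monoid G"
    using H by (rule additive_subgroup.a_subgroup)
  have "\<beta> ` ?P \<subseteq> carrier (add_monoid G)" using \<beta> by auto
  \<comment> \<open>\<open>h\<close> extends \<open>\<beta>\<close> additively to the free abelian
    group. The rest shows that \<open>h\<close> sends all generating relations, hence the whole
    relation subgroup, into \<open>H\<close>.\<close>
  then obtain h where h: "h \<in> hom ?F (add_monoid G)"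
    and h_of: "\<And>p. p \<in> ?P \<Longrightarrow> h (frag_of p) = \<beta> p"
    using comm_group.free_Abelian_group_universal[OF a_comm_group] by metis
  interpret h: group_hom ?F "add_monoid G" h
    using h by (simp add: group_hom_def group_hom_axioms_def a_group)
  have h_diff: "h (u - v) = h u \<ominus> h v" if "u \<in> carrier ?F" "v \<in> carrier ?F" for u v
  proof -
    have "h (u \<otimes>\<^bsub>?F\<^esub> inv\<^bsub>?F\<^esub> v) = h u \<oplus> (\<ominus> h v)"
      using that h.hom_mult[of u "inv\<^bsub>?F\<^esub> v"] h.hom_inv[of v] by (simp add: a_inv_def)
    then show ?thesis using that by (simp add: a_minus_def)
  qed
  have carr: "frag_of p \<in> carrier ?F" "frag_of p - frag_of q \<in> carrier ?F"
    if "p \<in> ?P" "q \<in> ?P" for p q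
    using that keys_diff[of "frag_of p" "frag_of q"] by auto
  have diff: "h (frag_of p - frag_of q) = \<beta> p \<ominus> \<beta> q" if "p \<in> ?P" "q \<in> ?P" for p q
    using that h_of h_diff carr by metis
  have diff3: "h (frag_of p - frag_of q - frag_of r) = \<beta> p \<ominus> \<beta> q \<ominus> \<beta> r"
    if "p \<in> ?P" "q \<in> ?P" "r \<in> ?P" for p q r
    using that h_diff[of "frag_of p - frag_of q" "frag_of r"] h_of diff carr by metis
  have rel: "h u \<in> H" if "u \<in> tensor_relations A M N" for u
    using that unfolding tensor_relations_def
    by (auto simp: diff diff3 add_left add_right balanced)
  have "h u \<in> H" if "u \<in> tensor_subgroup A M N" for u
    using that unfolding tensor_subgroup_def
  proof induction
    case one
    then show ?case using h.hom_one H.one_closed by simp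
  next
    case (incl u)
    then show ?case by (rule rel)
  next
    case (inv u)
    then have "u \<in> carrier ?F" using tensor_relations_carrier[OF M N] by blast
    then show ?case using h.hom_inv H.m_inv_closed[OF rel[OF inv]] by simp
  next
    case (eng u v)
    then have "u \<in> carrier ?F" "v \<in> carrier ?F"
      using subgroup.subset[OF subgroup_tensor_subgroup[OF M N]]
      unfolding tensor_subgroup_def by blast+
    then show ?case using h.hom_mult[of u v] H.m_closed[OF eng.IH] by simp
  qed
  from this[OF t] show ?thesis using diff x by simp
qed

section \<open>Denominators of elements of a flat overring\<close>

context cring
begin

text \<open>Besides \<open>B\<close> this covers \<open>A + A x\<close> and the quotient field, the
  two modules on which flatness is tested.\<close>

lemma module_subring_module:
  assumes A: "subring A R" and S: "submod A S"
  shows "module (R\<lparr>carrier := A\<rparr>) (subring_module R S)"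
proof -
  have c: "\<And>a. a \<in> A \<Longrightarrow> a \<in> carrier R" "\<And>x. x \<in> S \<Longrightarrow> x \<in> carrier R"
    using subringE(1)[OF A] submodD(1)[OF S] by auto
  have "cring (R\<lparr>carrier := A\<rparr>)"
    using subcring_iff subcringI'[OF A] subringE(1)[OF A] by blast
  moreover have "\<exists>y\<in>S. y \<oplus> x = \<zero>" if "x \<in> S" for x
    using that submod_uminus[OF A S] c l_neg by blast
  then have "abelian_group (subring_module R S)"
    using submodD[OF S] c by (intro abelian_groupI) (auto simp: subring_module_def a_ac)
  ultimately show ?thesis
    using submodD[OF S] c
    by (intro moduleI) (auto simp: subring_module_def l_distr r_distr m_assoc)
qed

end

lemma (in field) flat_overring_denominators:
  assumes flat: "flat_overring R A B" and x: "x \<in> B"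
  shows "\<one> \<in> denominators A A x \<cdot> B"
proof -
  let ?A = "R\<lparr>carrier := A\<rparr>" and ?D = "denominators A A x"
  have A: "subring A R" and B: "subring B R" and AB: "A \<subseteq> B"
    and fm: "flat_module ?A (subring_module R B)"
    and quot: "\<And>y. y \<in> carrier R \<Longrightarrow> \<exists>a\<in>A. \<exists>b\<in>A - {\<zero>}. y = a \<otimes> inv b"
    using flat by (auto simp: flat_overring_def overring_def is_quotient_field_def)
  note cA = subsetD[OF subringE(1)[OF A]] and cB = subsetD[OF subringE(1)[OF B]]
  have xc: "x \<in> carrier R" using x cB by blast
  \<comment> \<open>\<open>A + A x\<close> contains both 1 and \<open>x\<close>, and in it the
    coefficient of \<open>x\<close> is determined modulo \<open>?D\<close>.\<close>
  define S where "S = {c \<oplus> d \<otimes> x | c d. c \<in> A \<and> d \<in> A}"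
  let ?M = "subring_module R S" and ?K = "subring_module R (carrier R)"
    and ?B = "subring_module R B"
  have S: "submod A S"
    unfolding submod_def
  proof (intro conjI ballI)
    show "S \<subseteq> carrier R" using cA xc by (auto simp: S_def)
    have "\<zero> = \<zero> \<oplus> \<zero> \<otimes> x" using xc by simp
    then show "\<zero> \<in> S" using subringE(2)[OF A] unfolding S_def by blast
  next
    fix y z assume "y \<in> S" "z \<in> S"
    then obtain c d c' d' where *: "c \<in> A" "d \<in> A" "c' \<in> A" "d' \<in> A"
      "y = c \<oplus> d \<otimes> x" "z = c' \<oplus> d' \<otimes> x" unfolding S_def by blast
    then have "y \<oplus> z = (c \<oplus> c') \<oplus> (d \<oplus> d') \<otimes> x"
      using cA xc by (simp add: l_distr a_ac)
    then show "y \<oplus> z \<in> S" using * subringE(7)[OF A] unfolding S_def by blast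
  next
    fix a y assume "a \<in> A" "y \<in> S"
    then obtain c d where *: "a \<in> A" "c \<in> A" "d \<in> A" "y = c \<oplus> d \<otimes> x" unfolding S_def by blast
    then have "a \<otimes> y = a \<otimes> c \<oplus> (a \<otimes> d) \<otimes> x"
      using cA xc by (simp add: r_distr m_assoc)
    then show "a \<otimes> y \<in> S" using * subringE(6)[OF A] unfolding S_def by blast
  qed
  have "\<one> = \<one> \<oplus> \<zero> \<otimes> x" "x = \<zero> \<oplus> \<one> \<otimes> x" using xc by simp_all
  then have oneS: "\<one> \<in> S" and xS: "x \<in> S"
    using subringE(2,3)[OF A] unfolding S_def by blast+
  have mM: "module ?A ?M" and mK: "module ?A ?K" and mB: "module ?A ?B"
    using module_subring_module[OF A] S submod_subring[OF A _ B] AB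
      submod_subring[OF A subringE(1)[OF A] carrier_is_subring] by auto
  have id_hom: "(\<lambda>y. y) \<in> module_hom ?A ?M ?K"
    using submodD(1)[OF S] by (auto simp: module_hom_def subring_module_def)
  \<comment> \<open>With \<open>x = a / b\<close>, both tensors equal
    \<open>inv b \<otimes> a\<close> over the quotient field: move \<open>b\<close> across in
    \<open>(b inv b) \<otimes> x\<close>, and \<open>a\<close> across in
    \<open>(a inv b) \<otimes> 1\<close>.\<close>
  have "frag_of (\<one>, x) - frag_of (x, \<one>) \<in> tensor_subgroup ?A ?K ?B"
  proof -
    interpret T: subgroup "tensor_subgroup ?A ?K ?B"
      "free_Abelian_group (carrier ?K \<times> carrier ?B)"
      by (rule subgroup_tensor_subgroup[OF mK mB])
    obtain a b where ab: "a \<in> A" "b \<in> A" "b \<noteq> \<zero>" "x = a \<otimes> inv b"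
      using quot[OF xc] by blast
    have c: "a \<in> carrier R" "b \<in> carrier R" "b \<in> Units R"
      using ab cA by (auto simp: field_Units)
    have i: "inv b \<in> carrier R" "b \<otimes> inv b = \<one>" using c by simp_all
    have bx: "b \<otimes> x = a"
      using i c ab m_lcomm[of b a "inv b"] by simp
    have rel: "frag_of (r \<otimes> y, z) - frag_of (y, r \<otimes> z) \<in> tensor_subgroup ?A ?K ?B"
      if "r \<in> A" "y \<in> carrier R" "z \<in> B" for r y z
      unfolding tensor_subgroup_def tensor_relations_def
      using that by (intro generate.incl) (auto simp: subring_module_def)
    have r1: "frag_of (\<one>, x) - frag_of (inv b, a) \<in> tensor_subgroup ?A ?K ?B"
      using rel[of b "inv b" x] ab i x bx by simp
    have r2: "frag_of (x, \<one>) - frag_of (inv b, a) \<in> tensor_subgroup ?A ?K ?B"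
      using rel[of a "inv b" \<one>] ab i c subringE(3)[OF B] by simp
    have "frag_of (inv b, a) - frag_of (x, \<one>) \<in> tensor_subgroup ?A ?K ?B"
      using T.m_inv_closed[OF r2]
        inv_free_Abelian_group[OF carrier_free_Abelian_group_iff[THEN iffD1, OF T.mem_carrier[OF r2]]]
      by simp
    from T.m_closed[OF r1 this] show ?thesis by simp
  qed
  \<comment> \<open>Flatness is applied to the inclusion of \<open>A + A x\<close> into the quotient
    field.\<close>
  then have tens: "frag_of (\<one>, x) - frag_of (x, \<one>) \<in> tensor_subgroup ?A ?M ?B"
    using flat_module_injective[OF fm mM mK id_hom, of \<one> x x \<one>] oneS xS x subringE(3)[OF B]
    by (simp add: subring_module_def)
  have D: "submod A ?D" "?D \<subseteq> A"
    using submod_denominators[OF A submod_subring_self[OF A] xc] by (auto simp: denominators_def)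
  have DB: "submod B (?D \<cdot> B)"
    using submod_prod_right[OF subringE(1)[OF B] submod_subring_self[OF B], of ?D] submodD(1,2)[OF D(1)]
    by blast
  \<comment> \<open>\<open>\<delta>\<close> is the homomorphism \<open>A + A x \<rightarrow> A / D\<close>, \<open>c + d x \<mapsto> d\<close>, up to a choice of
    representatives; it is well defined since \<open>c + d x = 0\<close> forces \<open>d \<in> D\<close>.\<close>
  define \<delta> where "\<delta> y = (SOME d. d \<in> A \<and> y \<ominus> d \<otimes> x \<in> A)" for y
  have \<delta>: "\<delta> y \<in> A" "y \<ominus> \<delta> y \<otimes> x \<in> A" if "y \<in> S" for y
  proof -
    from that obtain c d where *: "c \<in> A" "d \<in> A" "y = c \<oplus> d \<otimes> x"
      unfolding S_def by blast
    then have "y \<ominus> d \<otimes> x = c" using cA xc by (simp add: a_minus_def a_assoc r_neg)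
    then have "\<exists>d. d \<in> A \<and> y \<ominus> d \<otimes> x \<in> A" using * by blast
    then show "\<delta> y \<in> A" "y \<ominus> \<delta> y \<otimes> x \<in> A"
      unfolding \<delta>_def by (metis (mono_tags, lifting) someI_ex)+
  qed
  have minus_closed: "u \<ominus> v \<in> A" if "u \<in> A" "v \<in> A" for u v
    using that subringE(5,7)[OF A] by (simp add: a_minus_def)
  have DB_I: "d \<otimes> b \<in> ?D \<cdot> B" if "d \<in> A" "d \<otimes> x \<in> A" "b \<in> B" for d b
    using that by (auto simp: denominators_def intro: ideal_prod.prod)
  have sc: "y \<in> carrier R" if "y \<in> S" for y using that submodD(1)[OF S] by blast
  note dc = cA[OF \<delta>(1)]
  \<comment> \<open>The map \<open>y \<otimes> b \<mapsto> \<delta> y b\<close> into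
    \<open>B / (?D \<cdot> B)\<close> is applied to the equality \<open>tens\<close>.\<close>
  have e1: "\<delta> \<one> \<otimes> x \<ominus> \<delta> x \<otimes> \<one> \<in> ?D \<cdot> B"
  proof -
    let ?\<beta> = "\<lambda>(y, b). \<delta> y \<otimes> b"
    have "?\<beta> (\<one>, x) \<ominus> ?\<beta> (x, \<one>) \<in> ?D \<cdot> B"
    proof (rule tensor_subgroup_balanced[OF mM mB _ _ _ _ _ _ _ _ _ tens])
      show "additive_subgroup (?D \<cdot> B) R"
        using DB submod_iff_additive_subgroup[OF B] by blast
      fix y b assume "y \<in> carrier ?M" "b \<in> carrier ?B"
      then have y: "y \<in> S" "b \<in> B" by (auto simp: subring_module_def)
      then show "?\<beta> (y, b) \<in> carrier R" using dc cB by simp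
      { fix z assume "z \<in> carrier ?M"
        then have z: "z \<in> S" by (simp add: subring_module_def)
        note yz = submodD(3)[OF S y(1) z]
        have c: "\<delta> (y \<oplus> z) \<in> carrier R" "\<delta> y \<in> carrier R" "\<delta> z \<in> carrier R"
          "y \<in> carrier R" "z \<in> carrier R" "b \<in> carrier R"
          using dc sc yz y z cB by auto
        \<comment> \<open>The failure of \<open>\<delta>\<close> to be additive lies in
          \<open>?D\<close>: multiplied by \<open>x\<close> it is a combination of three remainders
          \<open>y - \<delta> y x\<close>, each in \<open>A\<close>. The same argument serves for
          scalars below.\<close>
        have "(\<delta> (y \<oplus> z) \<ominus> \<delta> y \<ominus> \<delta> z) \<otimes> x =
          (y \<ominus> \<delta> y \<otimes> x) \<oplus> (z \<ominus> \<delta> z \<otimes> x) \<ominus> ((y \<oplus> z) \<ominus> \<delta> (y \<oplus> z) \<otimes> x)"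
          using c xc by algebra
        also have "\<dots> \<in> A" using \<delta> y z yz minus_closed subringE(7)[OF A] by simp
        finally have "(\<delta> (y \<oplus> z) \<ominus> \<delta> y \<ominus> \<delta> z) \<otimes> b \<in> ?D \<cdot> B"
          using \<delta> y z yz minus_closed by (intro DB_I) auto
        moreover have "(\<delta> (y \<oplus> z) \<ominus> \<delta> y \<ominus> \<delta> z) \<otimes> b = \<delta> (y \<oplus> z) \<otimes> b \<ominus> \<delta> y \<otimes> b \<ominus> \<delta> z \<otimes> b"
          using c by algebra
        ultimately show "?\<beta> (y \<oplus>\<^bsub>?M\<^esub> z, b) \<ominus> ?\<beta> (y, b) \<ominus> ?\<beta> (z, b) \<in> ?D \<cdot> B"
          by (simp add: subring_module_def) }
      { fix b' assume "b' \<in> carrier ?B"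
        then have c: "\<delta> y \<in> carrier R" "b \<in> carrier R" "b' \<in> carrier R"
          using dc y cB by (auto simp: subring_module_def)
        then have "\<delta> y \<otimes> (b \<oplus> b') \<ominus> \<delta> y \<otimes> b \<ominus> \<delta> y \<otimes> b' = \<zero>" by algebra
        then show "?\<beta> (y, b \<oplus>\<^bsub>?B\<^esub> b') \<ominus> ?\<beta> (y, b) \<ominus> ?\<beta> (y, b') \<in> ?D \<cdot> B"
          using submodD(2)[OF DB] by (simp add: subring_module_def) }
      { fix r assume "r \<in> carrier ?A"
        then have r: "r \<in> A" by simp
        note ry = submodD(4)[OF S r y(1)]
        have c: "\<delta> (r \<otimes> y) \<in> carrier R" "\<delta> y \<in> carrier R" "r \<in> carrier R"
          "y \<in> carrier R" "b \<in> carrier R"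
          using dc sc ry y cB r cA by auto
        have rd: "\<delta> (r \<otimes> y) \<ominus> r \<otimes> \<delta> y \<in> A"
          using \<delta> ry y r minus_closed subringE(6)[OF A] by simp
        have "(\<delta> (r \<otimes> y) \<ominus> r \<otimes> \<delta> y) \<otimes> x =
          r \<otimes> (y \<ominus> \<delta> y \<otimes> x) \<ominus> (r \<otimes> y \<ominus> \<delta> (r \<otimes> y) \<otimes> x)"
          using c xc by algebra
        also have "\<dots> \<in> A" using \<delta> y r ry minus_closed subringE(6)[OF A] by simp
        finally have "(\<delta> (r \<otimes> y) \<ominus> r \<otimes> \<delta> y) \<otimes> b \<in> ?D \<cdot> B"
          using rd y by (intro DB_I) auto
        moreover have "(\<delta> (r \<otimes> y) \<ominus> r \<otimes> \<delta> y) \<otimes> b = \<delta> (r \<otimes> y) \<otimes> b \<ominus> \<delta> y \<otimes> (r \<otimes> b)"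
          using c by algebra
        ultimately show "?\<beta> (r \<odot>\<^bsub>?M\<^esub> y, b) \<ominus> ?\<beta> (y, r \<odot>\<^bsub>?B\<^esub> b) \<in> ?D \<cdot> B"
          by (simp add: subring_module_def) }
    qed (use oneS xS x subringE(3)[OF B] in \<open>auto simp: subring_module_def\<close>)
    then show ?thesis by simp
  qed
  \<comment> \<open>The natural coefficients of 1 and \<open>x\<close> are 0 and 1. The chosen
    \<open>\<delta> \<one>\<close> and \<open>\<delta> x\<close> agree with them modulo
    \<open>?D\<close>, which is the content of \<open>e2\<close> and \<open>e3\<close>.\<close>
  have e2: "\<delta> \<one> \<otimes> x \<in> ?D \<cdot> B"
  proof (rule DB_I)
    have c: "\<delta> \<one> \<in> carrier R" using dc oneS by blast
    then have "\<delta> \<one> \<otimes> x = \<one> \<ominus> (\<one> \<ominus> \<delta> \<one> \<otimes> x)" using xc by algebra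
    also have "\<dots> \<in> A" using \<delta>(2)[OF oneS] subringE(3)[OF A] minus_closed by blast
    finally show "\<delta> \<one> \<otimes> x \<in> A" .
  qed (use \<delta> oneS x in auto)
  have e3: "(\<one> \<ominus> \<delta> x) \<otimes> \<one> \<in> ?D \<cdot> B"
  proof (rule DB_I)
    have c: "\<delta> x \<in> carrier R" using dc xS by blast
    then have "(\<one> \<ominus> \<delta> x) \<otimes> x = x \<ominus> \<delta> x \<otimes> x" using xc by algebra
    then show "(\<one> \<ominus> \<delta> x) \<otimes> x \<in> A" using \<delta>(2)[OF xS] by simp
  qed (use \<delta>(1)[OF xS] minus_closed subringE(3)[OF A] subringE(3)[OF B] in auto)
  have "\<delta> \<one> \<in> carrier R" "\<delta> x \<in> carrier R" using dc oneS xS by auto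
  \<comment> \<open>Modulo \<open>?D \<cdot> B\<close>, \<open>e2\<close> and \<open>e3\<close> turn
    the difference in \<open>e1\<close> into -1, so 1 is a combination of the three members.\<close>
  then have "\<one> = (\<one> \<ominus> \<delta> x) \<otimes> \<one> \<oplus> (\<delta> \<one> \<otimes> x \<oplus> \<ominus> (\<delta> \<one> \<otimes> x \<ominus> \<delta> x \<otimes> \<one>))"
    using xc by algebra
  also have "\<dots> \<in> ?D \<cdot> B"
    using submodD(3)[OF DB e3 submodD(3)[OF DB e2 submod_uminus[OF B DB e1]]] .
  finally show ?thesis .
qed

section \<open>Factorization of ideals of the overring\<close>

theorem proposition3:
  fixes K :: "('a, 'm) ring_scheme" and A B :: "'a set"
  assumes "ISP_domain K A"
    and "flat_overring K A B"
  shows "ISP_domain K B"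
proof -
  have qA: "is_quotient_field K A" and A: "subring A K" and B: "subring B K" and AB: "A \<subseteq> B"
    using assms(2) by (auto simp: flat_overring_def overring_def is_quotient_field_def)
  interpret field K using qA by (simp add: is_quotient_field_def)
  note dense = flat_overring_denominators[OF assms(2)]
  note ext = ideal_extension[OF A B AB dense] radical_ideal_extension[OF A B AB dense]
    invertible_ideal_extension[OF A B AB dense]
  have qB: "is_quotient_field K B"
    using qA B AB unfolding is_quotient_field_def by blast
  have "\<exists>J Qs. invertible_ideal K B J \<and> Qs \<noteq> [] \<and>
      (\<forall>Q\<in>set Qs. radical_ideal (K\<lparr>carrier := B\<rparr>) Q \<and> Q \<noteq> B) \<and>
      I = foldl (ideal_prod K) J Qs"
    if I: "ideal I (K\<lparr>carrier := B\<rparr>)" "I \<noteq> B" "I \<noteq> {\<zero>\<^bsub>K\<^esub>}" for I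
  proof -
    have sI: "submod B I" "I \<subseteq> B" using I ideal_iff_submod[OF B] by auto
    note contr = extension_contraction[OF A B AB dense sI]
    have sIA: "submod A (I \<inter> A)"
      using submod_inter submod_antimono[OF sI(1) AB] submod_subring_self[OF A] by blast
    then have "ideal (I \<inter> A) (K\<lparr>carrier := A\<rparr>)" by (simp add: ideal_iff_submod[OF A])
    moreover have "I \<inter> A \<noteq> A"
      using one_mem_submod[OF sI(1) subringE(1)[OF B]] subringE(3)[OF A] sI I(2) by blast
    \<comment> \<open>A zero contraction would extend to zero, but it extends to
      \<open>I\<close>.\<close>
    moreover have "I \<inter> A \<noteq> {\<zero>\<^bsub>K\<^esub>}"
    proof
      assume "I \<inter> A = {\<zero>\<^bsub>K\<^esub>}"
      then have "I = {\<zero>\<^bsub>K\<^esub>} \<cdot>\<^bsub>K\<^esub> B" using contr by simp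
      also have "\<dots> \<subseteq> {\<zero>\<^bsub>K\<^esub>}"
        by (rule ideal_prod_least) (use subringE(1)[OF B] in auto)
      finally show False using I(3) submodD(2)[OF sI(1)] by blast
    qed
    ultimately obtain J Qs where J: "invertible_ideal K A J" and Qs: "Qs \<noteq> []"
      and rad: "\<And>Q. Q \<in> set Qs \<Longrightarrow> radical_ideal (K\<lparr>carrier := A\<rparr>) Q \<and> Q \<noteq> A"
      and IA: "I \<inter> A = foldl (ideal_prod K) J Qs"
      using assms(1) unfolding ISP_domain_def ideal_prod_carrier_update by metis
    have sJ: "submod A J" "J \<subseteq> A"
      using J ideal_iff_submod[OF A] by (auto simp: invertible_ideal_def)
    have sQ: "submod A Q \<and> Q \<subseteq> A" if "Q \<in> set Qs" for Q
      using rad[OF that] ideal_iff_submod[OF A] by (auto simp: radical_ideal_def)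
    have sQB: "submod B (Q \<cdot>\<^bsub>K\<^esub> B)" if "Q \<in> set Qs" for Q
      using sQ[OF that] submod_extension[OF A B AB dense] by blast
    have sJB: "submod B (J \<cdot>\<^bsub>K\<^esub> B)" using submod_extension[OF A B AB dense] sJ by blast
    \<comment> \<open>A proper \<open>Q\<close> may extend to all of \<open>B\<close>; such factors
      are not admissible and are removed.\<close>
    let ?Ps = "filter (\<lambda>P. P \<noteq> B) (map (\<lambda>Q. Q \<cdot>\<^bsub>K\<^esub> B) Qs)"
    have "I = foldl (ideal_prod K) J Qs \<cdot>\<^bsub>K\<^esub> B" using contr IA by simp
    also have "\<dots> = foldl (ideal_prod K) (J \<cdot>\<^bsub>K\<^esub> B) (map (\<lambda>Q. Q \<cdot>\<^bsub>K\<^esub> B) Qs)"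
      using extension_foldl[OF B] sJ sQ submodD(1) by meson
    also have "\<dots> = foldl (ideal_prod K) (J \<cdot>\<^bsub>K\<^esub> B) ?Ps"
      using foldl_filter_unit[OF B sJB] sQB by simp
    finally have I_eq: "I = foldl (ideal_prod K) (J \<cdot>\<^bsub>K\<^esub> B) ?Ps" .
    \<comment> \<open>Otherwise \<open>I = J B\<close> contains \<open>J\<close>, so
      \<open>J\<close> lies in \<open>I \<inter> A\<close>, and therefore in \<open>J Q\<close> for
      the first factor \<open>Q\<close> of \<open>Qs\<close>. Cancelling \<open>J\<close> gives
      \<open>Q = A\<close>.\<close>
    have "?Ps \<noteq> []"
    proof
      assume "?Ps = []"
      then have "J \<cdot>\<^bsub>K\<^esub> B = I" using I_eq by simp
      moreover have "J \<subseteq> J \<cdot>\<^bsub>K\<^esub> B"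
        using submod_prod_subring[OF A sJ(1)] ideal_prod_mono[OF subset_refl AB] by blast
      ultimately have "J \<subseteq> foldl (ideal_prod K) J Qs" using IA sJ by blast
      moreover obtain Q Qs' where Q: "Qs = Q # Qs'" using Qs by (cases Qs) auto
      moreover have "submod A (J \<cdot>\<^bsub>K\<^esub> Q)"
        using submod_prod[OF subringE(1)[OF A] sJ(1)] sQ[of Q] submodD(1,2)[of A Q] Q by auto
      then have "foldl (ideal_prod K) (J \<cdot>\<^bsub>K\<^esub> Q) Qs' \<subseteq> J \<cdot>\<^bsub>K\<^esub> Q"
        using foldl_subset[OF A] sQ Q by simp
      ultimately have "J \<subseteq> J \<cdot>\<^bsub>K\<^esub> Q" by simp
      then have "A \<subseteq> Q" using invertible_ideal_cancel[OF A J] sQ Q by simp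
      then show False using rad[of Q] sQ[of Q] Q by auto
    qed
    moreover have "invertible_ideal K B (J \<cdot>\<^bsub>K\<^esub> B)" using ext(3) J by blast
    moreover have "\<forall>P\<in>set ?Ps. radical_ideal (K\<lparr>carrier := B\<rparr>) P \<and> P \<noteq> B"
      using ext(2) rad by auto
    ultimately show ?thesis using I_eq by blast
  qed
  then show ?thesis
    using qB unfolding ISP_domain_def ideal_prod_carrier_update by blast
qed

end
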